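(* Let $(a_n)_{n \ge 1}$ be a sequence of real numbers with $a_1 \ge a_2 \ge a_3 \ge \cdots \ge 0$, and let $s(1) < s(2) < s(3) < \cdots$ be any infinite strictly increasing sequence of positive integers. Then the subseries $\sum_{k \ge 1} a_{s(k)}$ converges if and only if \[ \sum_{n \ge s(1)} \frac{a_n}{\Delta s(S(n))} < \infty . \]
   Context: For a strictly increasing sequence $s(1) < s(2) < \cdots$ of positive integers, the forward differences are $\Delta s(k) = s(k+1) - s(k)$ for $k \ge 1$, and the counting function is $S(n) = \#\{k \ge 1 : s(k) \le n\}$. Thus $S(n) \ge 1$ for $n \ge s(1)$, and $\Delta s(S(n)) = s(S(n)+1) - s(S(n))$. *)

theory Defs
  imports Complex_Main
begin

text \<open>
  Sequences are indexed from 1, as functions on \<^typ>\<open>nat\<close> whose value at 0 plays no role.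
\<close>

definition forward_diff :: "(nat \<Rightarrow> nat) \<Rightarrow> nat \<Rightarrow> int" where
  "forward_diff s k = int (s (k + 1)) - int (s k)"

text \<open>
  For strictly increasing \<open>s\<close> the set below is finite, so \<^const>\<open>card\<close> is the true count.
\<close>

definition counting_fun :: "(nat \<Rightarrow> nat) \<Rightarrow> nat \<Rightarrow> nat" where
  "counting_fun s n = card {k. 1 \<le> k \<and> s k \<le> n}"

end

theory Submission
  imports Defs
begin

text \<open>
  The theorem is a Cauchy-condensation argument with arbitrary block ends. The integers
  \<open>n \<ge> s 1\<close> split into the blocks \<open>s k \<le> n < s (k + 1)\<close>, \<open>k \<ge> 1\<close>. On such a block the counting function
  is constantly \<open>k\<close>, so the weight \<open>1 / \<Delta>s(k)\<close> is the reciprocal of the number of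
  integers in the block, and the part of the weighted series over the block is the average of \<open>a\<close>
  there. As \<open>a\<close> decreases, this average lies between \<open>a (s (k + 1))\<close> and \<open>a (s k)\<close>
  (\<open>avg_between_endpoints\<close>), so the series of block averages is squeezed between the subseries
  and its own shift. Finally, all terms are nonnegative, and for such series grouping into
  finite blocks does not affect convergence (\<open>summable_iff_summable_blocks\<close>).
\<close>

lemma strict_mono_block_exists:
  fixes t :: "nat \<Rightarrow> nat"
  assumes "strict_mono t" and "t 0 = 0"
  obtains k where "t k \<le> n" and "n < t (Suc k)"
proof -
  have "n < t (Suc n)"
    using strict_mono_imp_increasing[OF assms(1), of "Suc n"] by simp
  then obtain k where "\<forall>i\<le>k. \<not> n < t i" and "n < t (Suc k)"
    using ex_least_nat_less[of "\<lambda>i. n < t i" "Suc n"] assms(2) by auto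
  then show thesis
    using that[of k] by (simp add: not_less)
qed

lemma sum_blocks:
  fixes t :: "nat \<Rightarrow> nat" and f :: "nat \<Rightarrow> 'a::comm_monoid_add"
  assumes "mono t" and "t 0 = 0"
  shows "(\<Sum>k<m. sum f {t k..<t (Suc k)}) = sum f {..<t m}"
proof (induction m)
  case 0
  then show ?case using assms(2) by simp
next
  case (Suc m)
  have "t m \<le> t (Suc m)"
    using assms(1) by (simp add: monoD)
  then have "sum f {0..<t m} + sum f {t m..<t (Suc m)} = sum f {0..<t (Suc m)}"
    by (simp add: sum.atLeastLessThan_concat)
  with Suc show ?case by (simp add: atLeast0LessThan)
qed

text \<open>
  The partial sums of the grouped series are the partial sums of \<open>f\<close> at the block ends. These are
  cofinal, and the partial sums of a nonnegative series increase, so one family is bounded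
  exactly when the other is. Without nonnegativity grouping could create convergence, as it does
  for \<open>1 - 1 + 1 - 1 + \<dots>\<close>.
\<close>

lemma summable_iff_summable_blocks:
  fixes t :: "nat \<Rightarrow> nat" and f :: "nat \<Rightarrow> real"
  assumes t: "strict_mono t" "t 0 = 0" and f: "\<And>n. 0 \<le> f n"
  shows "summable f \<longleftrightarrow> summable (\<lambda>k. sum f {t k..<t (Suc k)})"
    (is "_ \<longleftrightarrow> summable ?B")
proof
  have B: "0 \<le> ?B k" for k
    by (simp add: f sum_nonneg)
  have blocks: "(\<Sum>k<m. ?B k) = sum f {..<t m}" for m
    using sum_blocks[OF strict_mono_mono[OF t(1)] t(2)] .
  show "summable ?B" if "summable f"
  proof (rule summableI_nonneg_bounded[OF B])
    show "(\<Sum>k<m. ?B k) \<le> suminf f" for m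
      unfolding blocks using that f by (intro sum_le_suminf) auto
  qed
  show "summable f" if "summable ?B"
  proof (rule summableI_nonneg_bounded[OF f])
    fix m
    have "m \<le> t m"
      by (rule strict_mono_imp_increasing[OF t(1)])
    then have "sum f {..<m} \<le> sum f {..<t m}"
      by (intro sum_mono2) (auto simp: f)
    also have "\<dots> = (\<Sum>k<m. ?B k)"
      by (simp add: blocks)
    also have "\<dots> \<le> suminf ?B"
      using that B by (intro sum_le_suminf) auto
    finally show "sum f {..<m} \<le> suminf ?B" .
  qed
qed

lemma avg_between_endpoints:
  fixes f :: "nat \<Rightarrow> real"
  assumes "p < q" and mono: "\<And>i j. p \<le> i \<Longrightarrow> i \<le> j \<Longrightarrow> f j \<le> f i"
  shows "f q \<le> (\<Sum>n=p..<q. f n / (real q - real p))"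
    and "(\<Sum>n=p..<q. f n / (real q - real p)) \<le> f p"
proof -
  have d: "real (card {p..<q}) = real q - real p" "real q - real p > 0"
    using assms(1) by auto
  have "f q * (real q - real p) \<le> sum f {p..<q}"
    using sum_bounded_below[of "{p..<q}" "f q" f] mono d by (simp add: mult.commute)
  with d show "f q \<le> (\<Sum>n=p..<q. f n / (real q - real p))"
    by (simp add: sum_divide_distrib[symmetric] pos_le_divide_eq)
  have "sum f {p..<q} \<le> f p * (real q - real p)"
    using sum_bounded_above[of "{p..<q}" f "f p"] mono d by (simp add: mult.commute)
  with d show "(\<Sum>n=p..<q. f n / (real q - real p)) \<le> f p"
    by (simp add: sum_divide_distrib[symmetric] pos_divide_le_eq)
qed

lemma counting_fun_eq:
  assumes s: "strict_mono_on {1..} s" and "1 \<le> k" and "s k \<le> n" and "n < s (Suc k)"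
  shows "counting_fun s n = k"
proof -
  have "s j \<le> n \<longleftrightarrow> j \<le> k" if "1 \<le> j" for j
  proof
    assume "s j \<le> n"
    then have "s j < s (Suc k)" using assms(4) by simp
    then show "j \<le> k"
      using strict_mono_on_less[OF s, of j "Suc k"] that by simp
  next
    assume "j \<le> k"
    then have "s j \<le> s k"
      using strict_mono_on_less_eq[OF s, of j k] that assms(2) by simp
    then show "s j \<le> n" using assms(3) by simp
  qed
  then have "{j. 1 \<le> j \<and> s j \<le> n} = {1..k}" by auto
  then show ?thesis by (simp add: counting_fun_def)
qed

theorem theorem2:
  fixes a :: "nat \<Rightarrow> real" and s :: "nat \<Rightarrow> nat"
  assumes a_decreasing: "antimono_on {1..} a"
    and a_nonneg: "\<And>n. 1 \<le> n \<Longrightarrow> 0 \<le> a n"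
    and s_pos: "\<And>k. 1 \<le> k \<Longrightarrow> 1 \<le> s k"
    and s_increasing: "strict_mono_on {1..} s"
  shows "summable (\<lambda>k. a (s (k + 1))) \<longleftrightarrow>
         summable (\<lambda>n. a (s 1 + n) / real_of_int (forward_diff s (counting_fun s (s 1 + n))))"
    (is "summable ?sub \<longleftrightarrow> summable ?w")
proof -
  define p where "p = s 1"
  \<comment> \<open>The block boundaries, reindexed from 0 and measured from \<open>s 1\<close> like the summation variable of the
    weighted series; the truncated subtraction is exact.\<close>
  define t where "t k = s (Suc k) - p" for k
  define b where "b n = a (p + n)" for n
  have s_less: "s (Suc i) < s (Suc j)" if "i < j" for i j
    using strict_mono_onD[OF s_increasing, of "Suc i" "Suc j"] that by simp
  have s_t: "s (Suc k) = p + t k" for k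
    using s_less[of 0 k] by (cases k) (auto simp: t_def p_def)
  have t0: "t 0 = 0"
    by (simp add: t_def p_def)
  have p_pos: "1 \<le> p"
    using s_pos[of 1] by (simp add: p_def)
  have t_mono: "strict_mono t"
    using s_less unfolding s_t by (intro strict_monoI) simp
  have t_Suc: "t k < t (Suc k)" for k
    using t_mono by (simp add: strict_mono_Suc_iff)
  have b_mono: "b j \<le> b i" if "i \<le> j" for i j
    using monotone_onD[OF a_decreasing, of "p + i" "p + j"] p_pos that
    by (simp add: b_def)
  have b_nonneg: "0 \<le> b n" for n
    using a_nonneg[of "p + n"] p_pos by (simp add: b_def)
  have w_eq: "?w n = b n / (real (t (Suc k)) - real (t k))"
    if "t k \<le> n" and "n < t (Suc k)" for n k
  proof -
    have "counting_fun s (p + n) = Suc k"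
      by (rule counting_fun_eq[OF s_increasing]) (use that in \<open>simp_all add: s_t\<close>)
    then show ?thesis
      by (simp add: forward_diff_def b_def s_t t0)
  qed
  \<comment> \<open>The denominator is a difference of integers; that it is positive is seen from the block
    that contains \<open>n\<close>.\<close>
  have w_nonneg: "0 \<le> ?w n" for n
  proof -
    obtain k where k: "t k \<le> n" "n < t (Suc k)"
      by (rule strict_mono_block_exists[OF t_mono t0])
    show ?thesis
      unfolding w_eq[OF k] using b_nonneg[of n] t_Suc[of k] by simp
  qed
  define B where "B k = sum ?w {t k..<t (Suc k)}" for k
  have B_eq: "B k = (\<Sum>n=t k..<t (Suc k). b n / (real (t (Suc k)) - real (t k)))" for k
    unfolding B_def by (intro sum.cong refl w_eq) auto
  have lower: "b (t (Suc k)) \<le> B k" and upper: "B k \<le> b (t k)" for k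
    unfolding B_eq using avg_between_endpoints[OF t_Suc[of k], of b] b_mono by auto
  have B_nonneg: "0 \<le> B k" for k
    using lower[of k] b_nonneg[of "t (Suc k)"] by simp
  have "summable ?sub \<longleftrightarrow> summable (\<lambda>k. b (t k))"
    by (simp add: b_def s_t)
  also have "\<dots> \<longleftrightarrow> summable B"
  proof
    show "summable B" if "summable (\<lambda>k. b (t k))"
      by (rule summable_comparison_test'[OF that, of 0]) (use upper B_nonneg in simp)
    assume "summable B"
    then have "summable (\<lambda>k. b (t (Suc k)))"
      by (rule summable_comparison_test'[where N = 0]) (use lower b_nonneg in simp)
    then show "summable (\<lambda>k. b (t k))"
      using summable_Suc_iff[of "\<lambda>k. b (t k)"] by simp
  qed
  also have "\<dots> \<longleftrightarrow> summable ?w"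
    unfolding B_def by (rule summable_iff_summable_blocks[OF t_mono t0 w_nonneg, symmetric])
  finally show ?thesis .
qed

end
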